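(* Let $a^{(1)},a^{(2)},b^{(1)},b^{(2)}>0$ be constants and let $D_4$ be a diagonal-norm fourth-derivative SBP operator on $m$ grid points with associated $H,N$ and boundary vectors $e_l,e_r,d_{k;l},d_{k;r}$ ($k=1,2,3$). Let $A=\mathrm{diag}(a^{(1)},a^{(2)})$, $B=\mathrm{diag}(b^{(1)},b^{(2)})$, $\bar H=\begin{bmatrix} H & 0 \\ 0 & H \end{bmatrix}$, $$L=\begin{bmatrix}e_r^\top & -e_l^\top\\ d_{1;r}^\top & d_{1;l}^\top\\ a^{(1)}d_{2;r}^\top & a^{(2)}d_{2;l}^\top\\ a^{(1)}d_{3;r}^\top & a^{(2)}d_{3;l}^\top\end{bmatrix},\qquad P=I_{2m}-\bar H^{-1}L^\top(L\bar H^{-1}L^\top)^{-1}L .$$ Then the semi-discrete system for $w=\begin{bmatrix} v^{(1)} \\ v^{(2)} \end{bmatrix}\in\mathbb{R}^{2m}$, $$(B\otimes I_m)w_{tt}=-P(A\otimes D_4)Pw,$$ is a stable approximation (up to outer boundary terms) of the dynamic beam equation with piecewise constant parameters.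
   Context: The dynamic beam equation with piecewise constant parameters is $b^{(1)}u^{(1)}_{tt}=-a^{(1)}u^{(1)}_{xxxx}$ on $[x_l,0]$ and $b^{(2)}u^{(2)}_{tt}=-a^{(2)}u^{(2)}_{xxxx}$ on $[0,x_r]$, coupled at $x=0$ by the interface conditions $u^{(1)}=u^{(2)}$, $u^{(1)}_x=u^{(2)}_x$, $a^{(1)}u^{(1)}_{xx}=a^{(2)}u^{(2)}_{xx}$, $a^{(1)}u^{(1)}_{xxx}=a^{(2)}u^{(2)}_{xxx}$. The vectors $v^{(1)}(t),v^{(2)}(t)\in\mathbb{R}^m$ approximate $u^{(1)},u^{(2)}$ on equidistant grids; the same SBP operators are used in both blocks. The discrete interface conditions are $Lw=0$. $\otimes$ is the Kronecker product, $I_m$ and $I_{2m}$ are identity matrices. $e_l=(1,0,\dots,0)^\top$, $e_r=(0,\dots,0,1)^\top$. The rows of $L$ are assumed linearly independent, so that the inverse in $P$ exists. Diagonal-norm fourth-derivative SBP operator: a matrix $$D_4=H^{-1}\left(N+e_l d_{3;l}^\top+d_{1;l}d_{2;l}^\top+e_r d_{3;r}^\top-d_{1;r}d_{2;r}^\top\right)$$ approximating $\partial^4/\partial x^4$ (with a $2p$th-order accurate narrow stencil in the interior), where $H=H^\top>0$ is diagonal, $N=N^\top\ge 0$ (positive semi-definite), and, for a grid vector $v$ approximating $u$, $d_{1;l}^\top v\approx -u_x$, $d_{2;l}^\top v\approx -u_{xx}$, $d_{3;l}^\top v\approx -u_{xxx}$ at the left end point of the block and $d_{1;r}^\top v\approx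 u_x$, $d_{2;r}^\top v\approx u_{xx}$, $d_{3;r}^\top v\approx u_{xxx}$ at the right end point. Outer boundary conditions are assumed to be handled separately, so terms from the outer boundaries (left end of block 1, right end of block 2) are disregarded. Precisely, write $\|v\|_H^2=v^\top Hv$, $\begin{bmatrix} \tilde v^{(1)} \\ \tilde v^{(2)} \end{bmatrix}=Pw$, and $$BT=-2a^{(1)}\left(e_l^\top \tilde v^{(1)}_t\,d_{3;l}^\top \tilde v^{(1)}+d_{1;l}^\top \tilde v^{(1)}_t\,d_{2;l}^\top \tilde v^{(1)}\right)-2a^{(2)}\left(e_r^\top \tilde v^{(2)}_t\,d_{3;r}^\top \tilde v^{(2)}-d_{1;r}^\top \tilde v^{(2)}_t\,d_{2;r}^\top \tilde v^{(2)}\right)$$ for the outer boundary terms. Stable (in the energy sense, with zero data, up to outer boundary terms) means: there is a time-independent symmetric positive semi-definite matrix $M\in\mathbb{R}^{2m\times 2m}$ such that for every twice continuously differentiable solution $w(t)$ of the system, the energy $E=b^{(1)}\|v^{(1)}_t\|_H^2+b^{(2)}\|v^{(2)}_t\|_H^2+w^\top Mw$ satisfies $\frac{d}{dt}E\le BT$. *)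

theory Defs
  imports "HOL-Analysis.Analysis" "HOL-Computational_Algebra.Polynomial"
begin

text \<open>Unlike \<open>real^'n\<close>, these synonyms do not force the sort of \<open>'n\<close> to be just \<open>finite\<close>.\<close>

type_synonym 'n rvec = "(real, 'n) vec"
type_synonym 'n sqmat = "((real, 'n) vec, 'n) vec"

definition pos_semidef :: "real^'n^'n \<Rightarrow> bool" where
  "pos_semidef M \<longleftrightarrow> transpose M = M \<and> (\<forall>x. 0 \<le> x \<bullet> (M *v x))"

definition pos_def :: "real^'n^'n \<Rightarrow> bool" where
  "pos_def M \<longleftrightarrow> transpose M = M \<and> (\<forall>x. x \<noteq> 0 \<longrightarrow> 0 < x \<bullet> (M *v x))"

definition outer :: "real^'n \<Rightarrow> real^'k \<Rightarrow> real^'k^'n" where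
  "outer x y = (\<chi> i j. x $ i * y $ j)"

definition sqnorm_wrt :: "real^'n^'n \<Rightarrow> real^'n \<Rightarrow> real" where
  "sqnorm_wrt H v = v \<bullet> (H *v v)"

definition diag2 :: "real \<Rightarrow> real \<Rightarrow> real^2^2" where
  "diag2 x y = vector [vector [x, 0], vector [0, y]]"

text \<open>
  A vector of two stacked blocks of length \<open>m\<close> is indexed by \<open>2 \<times> 'm\<close>: the first component of
  the index selects the block, so that the Kronecker product with a \<open>2 \<times> 2\<close> matrix has its usual
  block structure.
\<close>

definition kron :: "real^'n^'n \<Rightarrow> real^'k^'k \<Rightarrow> real^('n \<times> 'k)^('n \<times> 'k)" where
  "kron X Y = (\<chi> r c. X $ fst r $ fst c * Y $ snd r $ snd c)"

definition stack :: "real^'m \<Rightarrow> real^'m \<Rightarrow> real^(2 \<times> 'm)" where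
  "stack x y = (\<chi> r. if fst r = 1 then x $ snd r else y $ snd r)"

definition block :: "2 \<Rightarrow> real^(2 \<times> 'm) \<Rightarrow> real^'m" where
  "block i w = (\<chi> k. w $ (i, k))"

definition block_diag :: "real^'m^'m \<Rightarrow> real^'m^'m \<Rightarrow> real^(2 \<times> 'm)^(2 \<times> 'm)" where
  "block_diag X Y =
     (\<chi> r c. if fst r \<noteq> fst c then 0
            else if fst r = 1 then X $ snd r $ snd c else Y $ snd r $ snd c)"

text \<open>
  The \<open>m\<close> grid points are the elements of a finite linearly ordered index type \<open>'m\<close>, from left to
  right; \<open>pos\<close> numbers them \<open>0, \<dots>, m - 1\<close>.
\<close>

definition pos :: "'m::{finite,linorder} \<Rightarrow> nat" where
  "pos i = card {j. j < i}"

definition e_l :: "'m::{finite,linorder} rvec" where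
  "e_l = axis (Min UNIV) 1"

definition e_r :: "'m::{finite,linorder} rvec" where
  "e_r = axis (Max UNIV) 1"

text \<open>Restriction of a polynomial to an equidistant grid with spacing \<open>h\<close> whose left end is \<open>0\<close>.\<close>

definition grid_fun :: "real \<Rightarrow> real poly \<Rightarrow> 'm::{finite,linorder} rvec" where
  "grid_fun h q = (\<chi> i. poly q (h * real (pos i)))"

text \<open>
  Accuracy of difference operators is expressed, as usual, by exactness on polynomials. As the spaces
  of polynomials of bounded degree are translation invariant, the position of the grid is irrelevant.

  In the interior, an operator approximating the fourth derivative with order \<open>2p\<close> is exact up to
  degree \<open>2p + 3\<close>, and the narrow (minimal) central stencil has \<open>2p + 3\<close> points. An interior row is
  one that is at least \<open>r\<close> points away from both ends, where \<open>r\<close> is the size of the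
  boundary closure; the stencil of such a row lies within the grid. Nothing is required of the rows in
  the closures: for \<open>p = 1\<close> they are not exact on cubics for the operators in use.
\<close>

definition interior_accurate ::
    "nat \<Rightarrow> real \<Rightarrow> 'm::{finite,linorder} sqmat \<Rightarrow> bool" where
  "interior_accurate p h D \<longleftrightarrow>
     (\<exists>r. p + 1 \<le> r \<and> 2 * r < CARD('m) \<and>
       (\<forall>i. r \<le> pos i \<and> pos i + r < CARD('m) \<longrightarrow>
          (\<forall>j. D $ i $ j \<noteq> 0 \<longrightarrow> pos j \<le> pos i + (p + 1) \<and> pos i \<le> pos j + (p + 1)) \<and>
          (\<forall>q. degree q \<le> 2 * p + 3 \<longrightarrow>
             (D *v grid_fun h q) $ i = poly ((pderiv ^^ 4) q) (h * real (pos i)))))"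

text \<open>
  Consistency of one-sided formulas for the \<open>k\<close>-th derivative at the end points, i.e. exactness up to
  degree \<open>k\<close>. At the left end point the formula approximates minus the derivative.
\<close>

definition approx_deriv_left ::
    "nat \<Rightarrow> real \<Rightarrow> 'm::{finite,linorder} rvec \<Rightarrow> bool" where
  "approx_deriv_left k h d \<longleftrightarrow>
     (\<forall>q. degree q \<le> k \<longrightarrow> d \<bullet> grid_fun h q = - poly ((pderiv ^^ k) q) 0)"

definition approx_deriv_right ::
    "nat \<Rightarrow> real \<Rightarrow> 'm::{finite,linorder} rvec \<Rightarrow> bool" where
  "approx_deriv_right k h d \<longleftrightarrow>
     (\<forall>q. degree q \<le> k \<longrightarrow>
        d \<bullet> grid_fun h q = poly ((pderiv ^^ k) q) (h * real (CARD('m) - 1)))"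

definition diagonal_norm_sbp4 ::
    "nat \<Rightarrow> real \<Rightarrow> 'm::{finite,linorder} sqmat \<Rightarrow> 'm sqmat \<Rightarrow>
     'm rvec \<Rightarrow> 'm rvec \<Rightarrow> 'm rvec \<Rightarrow> 'm rvec \<Rightarrow> 'm rvec \<Rightarrow> 'm rvec \<Rightarrow> 'm sqmat \<Rightarrow> bool" where
  "diagonal_norm_sbp4 p h H N d1l d2l d3l d1r d2r d3r D4 \<longleftrightarrow>
     D4 = matrix_inv H **
            (N + outer e_l d3l + outer d1l d2l + outer e_r d3r - outer d1r d2r) \<and>
     (\<forall>i j. i \<noteq> j \<longrightarrow> H $ i $ j = 0) \<and> pos_def H \<and> pos_semidef N \<and>
     interior_accurate p h D4 \<and>
     approx_deriv_left 1 h d1l \<and> approx_deriv_left 2 h d2l \<and> approx_deriv_left 3 h d3l \<and>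
     approx_deriv_right 1 h d1r \<and> approx_deriv_right 2 h d2r \<and> approx_deriv_right 3 h d3r"

text \<open>Outer boundary terms at the state \<open>z\<close> with time derivative \<open>z'\<close>.\<close>

definition outer_BT ::
    "real \<Rightarrow> real \<Rightarrow> 'm::{finite,linorder} rvec \<Rightarrow> 'm rvec \<Rightarrow> 'm rvec \<Rightarrow>
     'm rvec \<Rightarrow> 'm rvec \<Rightarrow> 'm rvec \<Rightarrow> (2 \<times> 'm) rvec \<Rightarrow> (2 \<times> 'm) rvec \<Rightarrow> real" where
  "outer_BT a1 a2 d1l d2l d3l d1r d2r d3r z z' =
     - 2 * a1 * ((e_l \<bullet> block 1 z') * (d3l \<bullet> block 1 z) + (d1l \<bullet> block 1 z') * (d2l \<bullet> block 1 z))
     - 2 * a2 * ((e_r \<bullet> block 2 z') * (d3r \<bullet> block 2 z) - (d1r \<bullet> block 2 z') * (d2r \<bullet> block 2 z))"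

text \<open>\<open>w\<close> is a twice continuously differentiable solution of \<open>K w'' = F w\<close> on \<open>T\<close>,
  with derivatives \<open>w'\<close> and \<open>w''\<close>.\<close>

definition C2_solution ::
    "real^'n^'n \<Rightarrow> real^'n^'n \<Rightarrow> real set \<Rightarrow>
     (real \<Rightarrow> real^'n) \<Rightarrow> (real \<Rightarrow> real^'n) \<Rightarrow> (real \<Rightarrow> real^'n) \<Rightarrow> bool" where
  "C2_solution K F T w w' w'' \<longleftrightarrow>
     (\<forall>t\<in>T. (w has_vector_derivative w' t) (at t within T)) \<and>
     (\<forall>t\<in>T. (w' has_vector_derivative w'' t) (at t within T)) \<and>
     continuous_on T w'' \<and>
     (\<forall>t\<in>T. K *v w'' t = F *v w t)"

text \<open>
  Energy stability, up to outer boundary terms, of the system \<open>K w'' = F w\<close>; the matrix \<open>M\<close> in the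
  energy depends neither on time nor on the solution nor on its interval \<open>T\<close> of existence.
\<close>

definition stable_up_to_outer_BT ::
    "real \<Rightarrow> real \<Rightarrow> real \<Rightarrow> real \<Rightarrow> 'm::{finite,linorder} sqmat \<Rightarrow>
     'm rvec \<Rightarrow> 'm rvec \<Rightarrow> 'm rvec \<Rightarrow> 'm rvec \<Rightarrow> 'm rvec \<Rightarrow> 'm rvec \<Rightarrow>
     (2 \<times> 'm) sqmat \<Rightarrow> (2 \<times> 'm) sqmat \<Rightarrow> (2 \<times> 'm) sqmat \<Rightarrow> bool" where
  "stable_up_to_outer_BT a1 a2 b1 b2 H d1l d2l d3l d1r d2r d3r P K F \<longleftrightarrow>
     (\<exists>M. pos_semidef M \<and>
       (\<forall>T w w' w''. is_interval T \<and> interior T \<noteq> {} \<and> C2_solution K F T w w' w'' \<longrightarrow>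
         (\<forall>t\<in>T. \<exists>E'.
            ((\<lambda>s. b1 * sqnorm_wrt H (block 1 (w' s)) + b2 * sqnorm_wrt H (block 2 (w' s))
                  + w s \<bullet> (M *v w s)) has_real_derivative E') (at t within T) \<and>
            E' \<le> outer_BT a1 a2 d1l d2l d3l d1r d2r d3r (P *v w t)
                   (vector_derivative (\<lambda>s. P *v w s) (at t within T)))))"

end

theory Submission
  imports Defs
begin

text \<open>
  The matrix \<open>P\<close> is the \<open>Hbar\<close>-orthogonal projection onto the kernel of \<open>L\<close>. Hence pairing the
  system with \<open>w'\<close> in the norm \<open>Hbar\<close> moves the outer \<open>P\<close> onto \<open>w'\<close>, and only the projected
  states \<open>z = P w\<close> and \<open>z' = P w'\<close> occur. The SBP property splits the right-hand side into the
  derivative of \<open>- w \<bullet> M w\<close> with \<open>M = P\<^sup>T (A \<otimes> N) P\<close>, the outer boundary terms, and interface terms;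
  the latter cancel because \<open>L z = 0\<close> and \<open>L z' = 0\<close>, so the energy estimate is even an equality.
\<close>

section \<open>Inverses of symmetric and positive definite matrices\<close>

lemma invertible_imp_matrix_inv:
  fixes A :: "real^'n^'n"
  assumes "invertible A"
  shows "A ** matrix_inv A = mat 1" "matrix_inv A ** A = mat 1"
  using someI_ex[OF assms[unfolded invertible_def]] unfolding matrix_inv_def by auto

lemma matrix_inv_symmetric:
  fixes A :: "real^'n^'n"
  assumes "invertible A" "transpose A = A"
  shows "transpose (matrix_inv A) = matrix_inv A"
proof -
  have "transpose (matrix_inv A) ** A = mat 1"
    by (metis assms invertible_imp_matrix_inv(1) matrix_transpose_mul transpose_mat)
  then show ?thesis
    by (metis assms(1) invertible_imp_matrix_inv(1) matrix_mul_assoc matrix_mul_lid matrix_mul_rid)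
qed

lemma inner_symmetric_matrix:
  fixes A :: "real^'n^'n"
  assumes "transpose A = A"
  shows "x \<bullet> (A *v y) = (A *v x) \<bullet> y"
  by (metis assms dot_lmul_matrix transpose_matrix_vector)

lemma inner_transpose_mult:
  fixes A :: "real^'n^'m"
  shows "x \<bullet> (transpose A *v y) = (A *v x) \<bullet> y"
  by (metis dot_lmul_matrix transpose_transpose transpose_matrix_vector inner_commute)

lemma pos_def_kernel_trivial:
  assumes "pos_def A" "x \<bullet> (A *v x) = 0"
  shows "x = 0"
  using assms unfolding pos_def_def by force

lemma invertible_if_kernel_trivial:
  fixes A :: "real^'n^'n"
  assumes "\<And>x. A *v x = 0 \<Longrightarrow> x = 0"
  shows "invertible A"
  using assms matrix_left_invertible_ker[of A] invertible_left_inverse[of A] by blast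

lemma pos_def_invertible:
  fixes A :: "real^'n^'n"
  assumes "pos_def A"
  shows "invertible A"
  by (rule invertible_if_kernel_trivial) (metis assms inner_zero_right pos_def_kernel_trivial)

text \<open>Substituting \<open>x = A *v y\<close> turns the quadratic form of the inverse at
  \<open>x\<close> into that of \<open>A\<close> at \<open>y\<close>.\<close>

lemma pos_def_matrix_inv:
  fixes A :: "real^'n^'n"
  assumes "pos_def A"
  shows "pos_def (matrix_inv A)"
  unfolding pos_def_def
proof (intro conjI allI impI)
  have inv: "invertible A" and sym: "transpose A = A"
    using assms pos_def_invertible by (auto simp: pos_def_def)
  show "transpose (matrix_inv A) = matrix_inv A"
    using matrix_inv_symmetric[OF inv sym] .
  fix x :: "real^'n" assume "x \<noteq> 0"
  define y where "y = matrix_inv A *v x"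
  have x: "x = A *v y"
    by (simp add: y_def matrix_vector_mul_assoc invertible_imp_matrix_inv[OF inv])
  with \<open>x \<noteq> 0\<close> have "y \<noteq> 0" by auto
  then have "0 < y \<bullet> (A *v y)" using assms by (simp add: pos_def_def)
  then show "0 < x \<bullet> (matrix_inv A *v x)"
    by (simp add: y_def[symmetric] x[symmetric] inner_commute)
qed

text \<open>\<open>rows L\<close> is a set and forgets repeated rows; injectivity of the row map
  gives it as many elements as \<open>L\<close> has row indices. Independence then means full row
  rank, so \<open>transpose L\<close> is injective.\<close>

lemma transpose_mult_eq_0_if_independent_rows:
  fixes L :: "real^'n^'k"
  assumes "inj (\<lambda>i. row i L)" "independent (rows L)" "transpose L *v x = 0"
  shows "x = 0"
proof -
  have "rows L = range (\<lambda>i. row i L)" by (auto simp: rows_def)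
  then have "card (rows L) = CARD('k)" using assms(1) by (simp add: card_image)
  then have "rank (transpose L) = CARD('k)"
    using assms(2) by (metis rank_transpose row_rank_def dim_eq_card_independent)
  then have "inj ((*v) (transpose L))" by (simp add: full_rank_injective)
  then show ?thesis using assms(3) by (metis injD matrix_vector_mult_0_right)
qed

text \<open>The form at \<open>x\<close> is the form of \<open>G\<close> at
  \<open>transpose L *v x\<close>, which is nonzero for \<open>x \<noteq> 0\<close>. With
  \<open>G\<close> the inverse norm matrix, this makes the inverse in the projection a genuine
  one.\<close>

lemma pos_def_congruence_independent_rows:
  fixes L :: "real^'n^'k" and G :: "real^'n^'n"
  assumes "pos_def G" "inj (\<lambda>i. row i L)" "independent (rows L)"
  shows "pos_def (L ** G ** transpose L)"
  unfolding pos_def_def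
proof (intro conjI allI impI)
  have "transpose G = G" using assms(1) by (simp add: pos_def_def)
  then show "transpose (L ** G ** transpose L) = L ** G ** transpose L"
    by (simp add: matrix_transpose_mul matrix_mul_assoc)
  fix x :: "real^'k" assume "x \<noteq> 0"
  then have "transpose L *v x \<noteq> 0"
    using transpose_mult_eq_0_if_independent_rows assms by blast
  then have "0 < (transpose L *v x) \<bullet> (G *v (transpose L *v x))"
    using assms(1) unfolding pos_def_def by blast
  then show "0 < x \<bullet> ((L ** G ** transpose L) *v x)"
    using inner_transpose_mult[of x "transpose L" "G *v (transpose L *v x)"]
    by (simp add: matrix_vector_mul_assoc[symmetric] del: transpose_matrix_vector)
qed

section \<open>The projection onto the kernel of the constraints\<close>

context
  fixes K :: "real^'n^'n" and L :: "real^'n^'k" and P :: "real^'n^'n"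
  assumes K: "pos_def K"
    and L: "inj (\<lambda>i. row i L)" "independent (rows L)"
    and P: "P = mat 1 - matrix_inv K ** transpose L **
                  matrix_inv (L ** matrix_inv K ** transpose L) ** L"
begin

text \<open>With \<open>S = L ** matrix_inv K ** transpose L\<close>, applying \<open>L\<close> to
  the correction term of \<open>P\<close> produces \<open>S ** matrix_inv S = mat 1\<close>, so the
  correction removes exactly \<open>L *v x\<close>.\<close>

lemma projection_constraint: "L *v (P *v x) = 0"
proof -
  define S where "S = L ** matrix_inv K ** transpose L"
  have S: "invertible S"
    unfolding S_def
    by (intro pos_def_invertible pos_def_congruence_independent_rows pos_def_matrix_inv K L)
  have "L *v (P *v x) = L *v x - (S ** matrix_inv S) *v (L *v x)"
    unfolding P S_def[symmetric]
    by (simp add: matrix_vector_mult_diff_rdistrib matrix_vector_mult_diff_distrib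
        S_def matrix_vector_mul_assoc matrix_mul_assoc)
  then show ?thesis using invertible_imp_matrix_inv(1)[OF S] by simp
qed

text \<open>Multiplying \<open>P\<close> by \<open>K\<close> cancels the leading
  \<open>matrix_inv K\<close> of the correction: \<open>K ** P\<close> equals
  \<open>K - transpose L ** matrix_inv S ** L\<close>, a difference of symmetric matrices.\<close>

lemma projection_self_adjoint: "x \<bullet> (K *v (P *v y)) = (P *v x) \<bullet> (K *v y)"
proof -
  define S where "S = L ** matrix_inv K ** transpose L"
  have S: "pos_def S"
    unfolding S_def
    by (intro pos_def_congruence_independent_rows pos_def_matrix_inv K L)
  then have "transpose (matrix_inv S) = matrix_inv S"
    using pos_def_matrix_inv pos_def_def by blast
  then have sym: "transpose (transpose L ** matrix_inv S ** L) = transpose L ** matrix_inv S ** L"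
    by (simp add: matrix_transpose_mul matrix_mul_assoc)
  have K_sym: "transpose K = K" using K by (simp add: pos_def_def)
  have KP: "K *v (P *v z) = K *v z - (transpose L ** matrix_inv S ** L) *v z" for z
    unfolding P S_def[symmetric]
    by (simp add: matrix_vector_mult_diff_rdistrib matrix_vector_mult_diff_distrib
        matrix_vector_mul_assoc matrix_mul_assoc
        invertible_imp_matrix_inv(1)[OF pos_def_invertible[OF K]])
  have "x \<bullet> (K *v (P *v y)) = (K *v (P *v x)) \<bullet> y"
    unfolding KP inner_diff_left inner_diff_right
    using inner_symmetric_matrix[OF K_sym] inner_symmetric_matrix[OF sym] by simp
  then show ?thesis using inner_symmetric_matrix[OF K_sym] by simp
qed

end

section \<open>Two-block vectors and Kronecker products with diagonal matrices\<close>

lemma sum_UNIV_prod_2: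
  fixes f :: "2 \<times> 'm::finite \<Rightarrow> 'a::comm_monoid_add"
  shows "(\<Sum>r\<in>UNIV. f r) = (\<Sum>k\<in>UNIV. f (1, k)) + (\<Sum>k\<in>UNIV. f (2, k))"
proof -
  have "(\<Sum>r\<in>UNIV. f r) = (\<Sum>i\<in>UNIV. \<Sum>k\<in>UNIV. f (i, k))"
    by (simp add: sum.cartesian_product UNIV_Times_UNIV[symmetric] del: UNIV_Times_UNIV)
  then show ?thesis by (simp add: sum_2)
qed

lemma inner_blocks:
  fixes x y :: "real^(2 \<times> 'm::finite)"
  shows "x \<bullet> y = block 1 x \<bullet> block 1 y + block 2 x \<bullet> block 2 y"
  by (simp add: inner_vec_def sum_UNIV_prod_2 block_def)

lemma block_stack [simp]: "block 1 (stack x y) = x" "block 2 (stack x y) = y"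
  by (simp_all add: block_def stack_def vec_eq_iff)

lemma eq_iff_blocks:
  fixes x y :: "real^(2 \<times> 'm::finite)"
  shows "x = y \<longleftrightarrow> block 1 x = block 1 y \<and> block 2 x = block 2 y"
  by (auto simp: vec_eq_iff block_def forall_2)

lemma diag2_nth [simp]:
  "diag2 x y $ 1 $ 1 = x" "diag2 x y $ 1 $ 2 = 0"
  "diag2 x y $ 2 $ 1 = 0" "diag2 x y $ 2 $ 2 = y"
  by (simp_all add: diag2_def vector_2)

lemma block_kron_diag2_mult:
  fixes X :: "real^'m::finite^'m"
  shows "block 1 (kron (diag2 x y) X *v z) = x *\<^sub>R (X *v block 1 z)"
    and "block 2 (kron (diag2 x y) X *v z) = y *\<^sub>R (X *v block 2 z)"
  by (simp_all add: block_def kron_def matrix_vector_mult_def vec_eq_iff sum_UNIV_prod_2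
      sum_distrib_left mult.assoc)

text \<open>Brings the norm of the coupled system into Kronecker form, where the blockwise rules and
  definiteness results apply.\<close>

lemma block_diag_eq_kron:
  fixes X :: "real^'m::finite^'m"
  shows "block_diag X X = kron (diag2 1 1) X"
proof -
  have "block_diag X X $ r $ c = kron (diag2 1 1) X $ r $ c" for r c
    using exhaust_2[of "fst r"] exhaust_2[of "fst c"]
    by (auto simp: block_diag_def kron_def)
  then show ?thesis by (simp add: vec_eq_iff)
qed

lemma transpose_kron_diag2:
  fixes X :: "real^'m::finite^'m"
  assumes "transpose X = X"
  shows "transpose (kron (diag2 x y) X) = kron (diag2 x y) X"
proof -
  have X: "X $ i $ j = X $ j $ i" for i j
    using assms by (metis (no_types) transpose_def vec_lambda_beta)
  have "diag2 x y $ i $ j = diag2 x y $ j $ i" for i j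
    using exhaust_2[of i] exhaust_2[of j] by auto
  then show ?thesis by (simp add: vec_eq_iff transpose_def kron_def X)
qed

lemma pos_semidef_kron_diag2:
  fixes X :: "real^'m::finite^'m"
  assumes "pos_semidef X" "0 \<le> x" "0 \<le> y"
  shows "pos_semidef (kron (diag2 x y) X)"
  using assms
  by (simp add: pos_semidef_def transpose_kron_diag2 inner_blocks block_kron_diag2_mult)

lemma pos_def_kron_diag2:
  fixes X :: "real^'m::finite^'m"
  assumes "pos_def X" "0 < x" "0 < y"
  shows "pos_def (kron (diag2 x y) X)"
  unfolding pos_def_def
proof (intro conjI allI impI)
  show "transpose (kron (diag2 x y) X) = kron (diag2 x y) X"
    using assms(1) by (simp add: pos_def_def transpose_kron_diag2)
  fix z :: "real^(2 \<times> 'm)" assume "z \<noteq> 0"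
  moreover have "block i 0 = (0 :: real^'m)" for i by (simp add: block_def vec_eq_iff)
  ultimately have "block 1 z \<noteq> 0 \<or> block 2 z \<noteq> 0" using eq_iff_blocks[of z 0] by simp
  moreover have nonneg: "0 \<le> u \<bullet> (X *v u)" for u
    using assms(1) by (cases "u = 0") (auto simp: pos_def_def less_imp_le)
  moreover have "u \<noteq> 0 \<Longrightarrow> 0 < u \<bullet> (X *v u)" for u using assms(1) by (simp add: pos_def_def)
  ultimately show "0 < z \<bullet> (kron (diag2 x y) X *v z)"
    using assms(2,3)
    by (auto simp: inner_blocks block_kron_diag2_mult intro: add_pos_nonneg add_nonneg_pos)
qed

section \<open>Quadratic forms and rank-one terms\<close>

lemma pos_semidef_congruence:
  fixes P M :: "real^'n^'n"
  assumes "pos_semidef M"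
  shows "pos_semidef (transpose P ** M ** P)"
proof -
  have "x \<bullet> ((transpose P ** M ** P) *v x) = (P *v x) \<bullet> (M *v (P *v x))" for x
    by (simp add: matrix_vector_mul_assoc[symmetric] inner_transpose_mult
        del: transpose_matrix_vector)
  then show ?thesis
    using assms by (simp add: pos_semidef_def matrix_transpose_mul matrix_mul_assoc)
qed

lemma outer_mult: "outer x y *v z = (y \<bullet> z) *\<^sub>R x"
  by (simp add: vec_eq_iff outer_def matrix_vector_mult_def inner_vec_def sum_distrib_left
      sum_distrib_right mult.assoc mult.left_commute mult.commute)

lemma has_real_derivative_quadratic_form:
  fixes Q :: "real^'n^'n"
  assumes "transpose Q = Q" "(w has_vector_derivative w') (at t within T)"
  shows "((\<lambda>s. w s \<bullet> (Q *v w s)) has_real_derivative 2 * (w' \<bullet> (Q *v w t))) (at t within T)"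
proof -
  have "((\<lambda>s. Q *v w s) has_vector_derivative Q *v w') (at t within T)"
    using assms(2) bounded_linear.has_vector_derivative matrix_vector_mul_bounded_linear by blast
  from bounded_bilinear.has_vector_derivative[OF bounded_bilinear_inner assms(2) this]
  show ?thesis
    using inner_symmetric_matrix[OF assms(1), of "w t" w']
    by (simp add: has_real_derivative_iff_has_vector_derivative inner_commute)
qed

lemma vector_4_nth:
  fixes x1 x2 x3 x4 :: "'a::zero"
  shows "(vector [x1, x2, x3, x4] :: 'a^4) $ 1 = x1"
    and "(vector [x1, x2, x3, x4] :: 'a^4) $ 2 = x2"
    and "(vector [x1, x2, x3, x4] :: 'a^4) $ 3 = x3"
    and "(vector [x1, x2, x3, x4] :: 'a^4) $ 4 = x4"
  by (simp_all add: vector_def)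

text \<open>A case of the mixed-product rule. It factors the weighted mass matrix
  \<open>kron B H\<close> into the norm \<open>Hbar\<close> and the matrix
  \<open>kron B (mat 1)\<close> in front of the second time derivative.\<close>

lemma kron_diag2_mult_split:
  fixes X :: "real^'m::finite^'m"
  shows "kron (diag2 x y) X *v z = kron (diag2 1 1) X *v (kron (diag2 x y) (mat 1) *v z)"
  by (simp add: eq_iff_blocks block_kron_diag2_mult matrix_vector_mult_scaleR)

section \<open>The energy estimate for the coupled beam\<close>

theorem lemma6:
  fixes a1 a2 b1 b2 h :: real
    and p :: nat
    and H N D4 :: "'m::{finite,linorder} sqmat"
    and d1l d2l d3l d1r d2r d3r :: "'m rvec"
    and A B :: "real^2^2"
    and Hbar P :: "(2 \<times> 'm) sqmat"
    and L :: "((2 \<times> 'm) rvec, 4) vec"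
  assumes "a1 > 0" "a2 > 0" "b1 > 0" "b2 > 0"
    and "p \<ge> 1" "h > 0"
    and "diagonal_norm_sbp4 p h H N d1l d2l d3l d1r d2r d3r D4"
    and "A = diag2 a1 a2" "B = diag2 b1 b2"
    and "Hbar = block_diag H H"
    and "L = vector [stack e_r (- e_l),
                     stack d1r d1l,
                     stack (a1 *\<^sub>R d2r) (a2 *\<^sub>R d2l),
                     stack (a1 *\<^sub>R d3r) (a2 *\<^sub>R d3l)]"
    and "inj (\<lambda>i. row i L)" "independent (rows L)"
    and "P = mat 1 - matrix_inv Hbar ** transpose L **
                       matrix_inv (L ** matrix_inv Hbar ** transpose L) ** L"
  shows "stable_up_to_outer_BT a1 a2 b1 b2 H d1l d2l d3l d1r d2r d3r P
           (kron B (mat 1)) (- (P ** kron A D4 ** P))"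
proof -
  note sbp = assms(7)[unfolded diagonal_norm_sbp4_def]
  have H: "pos_def H" and N: "pos_semidef N" using sbp by auto
  \<comment> \<open>Summation by parts: multiplying by the norm leaves the symmetric part
    \<open>N\<close> and four rank-one boundary terms.\<close>
  have HD: "H *v (D4 *v x) = N *v x + (d3l \<bullet> x) *\<^sub>R e_l + (d2l \<bullet> x) *\<^sub>R d1l
      + (d3r \<bullet> x) *\<^sub>R e_r - (d2r \<bullet> x) *\<^sub>R d1r" for x
  proof -
    have "H ** D4 = N + outer e_l d3l + outer d1l d2l + outer e_r d3r - outer d1r d2r"
      using sbp invertible_imp_matrix_inv(1)[OF pos_def_invertible[OF H]]
      by (simp add: matrix_mul_assoc)
    then have "H *v (D4 *v x) =
        (N + outer e_l d3l + outer d1l d2l + outer e_r d3r - outer d1r d2r) *v x"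
      by (simp add: matrix_vector_mul_assoc)
    then show ?thesis
      by (simp add: matrix_vector_mult_add_rdistrib matrix_vector_mult_diff_rdistrib outer_mult)
  qed
  have Hbar_kron: "Hbar = kron (diag2 1 1) H" using assms(10) by (simp add: block_diag_eq_kron)
  have Hbar: "pos_def Hbar" unfolding Hbar_kron using H by (intro pos_def_kron_diag2) auto
  have constraint: "L *v (P *v x) = 0" for x
    by (rule projection_constraint[OF Hbar assms(12,13,14)])
  have adjoint: "x \<bullet> (Hbar *v (P *v y)) = (P *v x) \<bullet> (Hbar *v y)" for x y
    by (rule projection_self_adjoint[OF Hbar assms(12,13,14)])
  \<comment> \<open>One equation per row of \<open>L\<close>. The minus signs express continuity,
    since the formulas at the left end of block 2 approximate the negatives of the
    derivatives.\<close>
  have interface: "e_r \<bullet> block 1 z = e_l \<bullet> block 2 z" "d1r \<bullet> block 1 z = - (d1l \<bullet> block 2 z)"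
      "a1 * (d2r \<bullet> block 1 z) = - (a2 * (d2l \<bullet> block 2 z))"
      "a1 * (d3r \<bullet> block 1 z) = - (a2 * (d3l \<bullet> block 2 z))"
    if "L *v z = 0" for z
  proof -
    have "L $ i \<bullet> z = 0" for i
      using that by (metis matrix_vector_mul_component zero_index)
    then have "L $ 1 \<bullet> z = 0" "L $ 2 \<bullet> z = 0" "L $ 3 \<bullet> z = 0" "L $ 4 \<bullet> z = 0" by blast+
    then show "e_r \<bullet> block 1 z = e_l \<bullet> block 2 z" "d1r \<bullet> block 1 z = - (d1l \<bullet> block 2 z)"
      "a1 * (d2r \<bullet> block 1 z) = - (a2 * (d2l \<bullet> block 2 z))"
      "a1 * (d3r \<bullet> block 1 z) = - (a2 * (d3l \<bullet> block 2 z))"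
      unfolding assms(11) vector_4_nth by (simp_all add: inner_blocks)
  qed
  \<comment> \<open>The potential energy uses \<open>N\<close> at the projected state, so that its
    rate cancels the \<open>N\<close> part of \<open>D4\<close>.\<close>
  define M where "M = transpose P ** kron A N ** P"
  have M: "pos_semidef M"
    unfolding M_def assms(8) using assms(1,2) N
    by (intro pos_semidef_congruence pos_semidef_kron_diag2) auto
  have BH_sym: "transpose (kron B H) = kron B H"
    unfolding assms(9) using H by (intro transpose_kron_diag2) (simp add: pos_def_def)

  \<comment> \<open>For \<open>z = P w\<close> and \<open>z' = P w'\<close>, the first term is the
    rate of the potential energy and the second that of the kinetic energy.\<close>
  have energy_rate: "2 * (z' \<bullet> (kron A N *v z)) - 2 * (z' \<bullet> (Hbar *v (kron A D4 *v z)))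
      = outer_BT a1 a2 d1l d2l d3l d1r d2r d3r z z'" if z: "L *v z = 0" "L *v z' = 0" for z z'
  proof -
    have "z' \<bullet> (Hbar *v (kron A D4 *v z)) - z' \<bullet> (kron A N *v z)
      = a1 * ((e_l \<bullet> block 1 z') * (d3l \<bullet> block 1 z) + (d1l \<bullet> block 1 z') * (d2l \<bullet> block 1 z))
      + a2 * ((e_r \<bullet> block 2 z') * (d3r \<bullet> block 2 z) - (d1r \<bullet> block 2 z') * (d2r \<bullet> block 2 z))
      + ((e_r \<bullet> block 1 z') * (a1 * (d3r \<bullet> block 1 z))
      - (d1r \<bullet> block 1 z') * (a1 * (d2r \<bullet> block 1 z))
      + (e_l \<bullet> block 2 z') * (a2 * (d3l \<bullet> block 2 z)) + (d1l \<bullet> block 2 z') * (a2 * (d2l \<bullet> block 2 z)))"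
      unfolding Hbar_kron assms(8)
      by (simp add: inner_blocks block_kron_diag2_mult matrix_vector_mult_scaleR HD
          inner_add_right inner_diff_right inner_commute algebra_simps)
    \<comment> \<open>The first two interface conditions are applied to \<open>z'\<close> and the
      last two to \<open>z\<close>; \<open>a1\<close> and \<open>a2\<close> stay attached to the
      second and third derivatives to match those rows of \<open>L\<close>. The block 1 terms then
      become the negatives of the block 2 terms.\<close>
    also have "(e_r \<bullet> block 1 z') * (a1 * (d3r \<bullet> block 1 z))
      - (d1r \<bullet> block 1 z') * (a1 * (d2r \<bullet> block 1 z))
      + (e_l \<bullet> block 2 z') * (a2 * (d3l \<bullet> block 2 z)) + (d1l \<bullet> block 2 z') * (a2 * (d2l \<bullet> block 2 z)) = 0"
      unfolding interface[OF z(1)] interface[OF z(2)] by simp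
    finally show ?thesis unfolding outer_BT_def by (simp add: algebra_simps)
  qed

  show ?thesis
    unfolding stable_up_to_outer_BT_def
  proof (intro exI[of _ M] conjI M allI impI ballI)
    fix T w w' w'' and t :: real
    assume asm: "is_interval T \<and> interior T \<noteq> {} \<and>
        C2_solution (kron B (mat 1)) (- (P ** kron A D4 ** P)) T w w' w''" and t: "t \<in> T"
    then have dw: "(w has_vector_derivative w' t) (at t within T)"
      and dw': "(w' has_vector_derivative w'' t) (at t within T)"
      and ode: "kron B (mat 1) *v w'' t = (- (P ** kron A D4 ** P)) *v w t"
      by (auto simp: C2_solution_def)
    \<comment> \<open>A singleton has empty interior. An interval with more than one point has no
      isolated points, so the derivative within \<open>T\<close> is unique, also at an end point of
      \<open>T\<close>.\<close>
    have "T \<noteq> {x}" for x using asm by auto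
    then have "t islimpt T"
      using asm t by (intro connected_imp_perfect) (auto simp: is_interval_connected)
    then have "at t within T \<noteq> bot" by (simp add: trivial_limit_within)
    moreover have "((\<lambda>s. P *v w s) has_vector_derivative P *v w' t) (at t within T)"
      using dw bounded_linear.has_vector_derivative matrix_vector_mul_bounded_linear by blast
    ultimately have dz: "vector_derivative (\<lambda>s. P *v w s) (at t within T) = P *v w' t"
      by (rule vector_derivative_within)

    define E' where "E' = 2 * (w'' t \<bullet> (kron B H *v w' t)) + 2 * (w' t \<bullet> (M *v w t))"
    have kinetic: "b1 * sqnorm_wrt H (block 1 v) + b2 * sqnorm_wrt H (block 2 v)
        = v \<bullet> (kron B H *v v)" for v
      by (simp add: assms(9) sqnorm_wrt_def inner_blocks block_kron_diag2_mult)
    have deriv: "((\<lambda>s. b1 * sqnorm_wrt H (block 1 (w' s)) + b2 * sqnorm_wrt H (block 2 (w' s))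
        + w s \<bullet> (M *v w s)) has_real_derivative E') (at t within T)"
      unfolding kinetic E'_def using M
      by (intro DERIV_add has_real_derivative_quadratic_form BH_sym dw dw') (simp add: pos_semidef_def)

    have minus_mult: "(- X) *v x = - (X *v x)" for X :: "(2 \<times> 'm) sqmat" and x
      by (simp add: vec_eq_iff matrix_vector_mult_def sum_negf)
    \<comment> \<open>Symmetry puts \<open>w''\<close> on the right, where splitting
      \<open>kron B H\<close> exposes the left-hand side of the system. Self-adjointness then moves
      the outer \<open>P\<close> onto \<open>w'\<close>.\<close>
    have "w'' t \<bullet> (kron B H *v w' t) = w' t \<bullet> (kron B H *v w'' t)"
      using inner_symmetric_matrix[OF BH_sym] by (simp add: inner_commute)
    also have "\<dots> = w' t \<bullet> (Hbar *v (kron B (mat 1) *v w'' t))"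
      unfolding Hbar_kron assms(9) by (metis kron_diag2_mult_split)
    also have "\<dots> = - (w' t \<bullet> (Hbar *v (P *v (kron A D4 *v (P *v w t)))))"
      unfolding ode by (simp add: minus_mult matrix_vector_mul_assoc matrix_mul_assoc
          linear_neg[OF matrix_vector_mul_linear])
    also have "\<dots> = - ((P *v w' t) \<bullet> (Hbar *v (kron A D4 *v (P *v w t))))"
      unfolding adjoint ..
    finally have K: "w'' t \<bullet> (kron B H *v w' t) =
        - ((P *v w' t) \<bullet> (Hbar *v (kron A D4 *v (P *v w t))))" .
    have "w' t \<bullet> (M *v w t) = (P *v w' t) \<bullet> (kron A N *v (P *v w t))"
      by (simp add: M_def matrix_vector_mul_assoc[symmetric] inner_transpose_mult
          del: transpose_matrix_vector)
    with K have "E' = outer_BT a1 a2 d1l d2l d3l d1r d2r d3r (P *v w t) (P *v w' t)"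
      unfolding E'_def energy_rate[OF constraint constraint, symmetric] by simp
    with deriv dz show "\<exists>E'. ((\<lambda>s. b1 * sqnorm_wrt H (block 1 (w' s))
        + b2 * sqnorm_wrt H (block 2 (w' s))
        + w s \<bullet> (M *v w s)) has_real_derivative E') (at t within T) \<and>
        E' \<le> outer_BT a1 a2 d1l d2l d3l d1r d2r d3r (P *v w t)
               (vector_derivative (\<lambda>s. P *v w s) (at t within T))"
      by auto
  qed
qed

end
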